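(* Let $G$ be a metabelian group. Then the group $\mathrm{P}(G)$, i.e. the subgroup of the automorphism group of $G$ generated by all polynomial automorphisms of $G$, is metabelian.
   Context: For a group $G$, $\mathrm{A}(G)$ denotes its automorphism group. An automorphism $f\in \mathrm{A}(G)$ is called a polynomial automorphism of $G$ if there exist integers $\epsilon_1,\ldots,\epsilon_m\in\mathbb{Z}$ and elements $u_0,\ldots,u_m\in G$ such that $f(x)=u_0x^{\epsilon_1}u_1\cdots u_{m-1}x^{\epsilon_m}u_m$ for all $x\in G$ (equivalently, since $f(1)=1$, there exist integers $\epsilon_1,\ldots,\epsilon_m$ and elements $v_1,\ldots,v_m\in G$ with $f(x)=(v_1^{-1}x^{\epsilon_1}v_1)\cdots(v_m^{-1}x^{\epsilon_m}v_m)$ for all $x\in G$). $\mathrm{P}(G)$ denotes the subgroup of $\mathrm{A}(G)$ generated by the set of all polynomial automorphisms of $G$. A group is metabelian if its derived subgroup is abelian. *)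

theory Defs
  imports "HOL-Algebra.Bij" "HOL-Algebra.Generated_Groups"
begin

definition metabelian :: "('a, 'b) monoid_scheme \<Rightarrow> bool"
  where "metabelian G \<longleftrightarrow> group G \<and> comm_group (G\<lparr>carrier := derived G (carrier G)\<rparr>)"

text \<open>
  The value at \<open>x\<close> of the word \<open>u\<^sub>0 x\<^sup>e\<^sup>1 u\<^sub>1 \<dots> x\<^sup>e\<^sup>m u\<^sub>m\<close>, which is encoded by its first
  coefficient \<open>u\<^sub>0\<close> and the list \<open>[(e\<^sub>1, u\<^sub>1), \<dots>, (e\<^sub>m, u\<^sub>m)]\<close>.
\<close>
primrec word_value ::
  "('a, 'b) monoid_scheme \<Rightarrow> 'a \<Rightarrow> (int \<times> 'a) list \<Rightarrow> 'a \<Rightarrow> 'a"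
  where
    "word_value G u [] x = u"
  | "word_value G u (p # ps) x = u \<otimes>\<^bsub>G\<^esub> x [^]\<^bsub>G\<^esub> fst p \<otimes>\<^bsub>G\<^esub> word_value G (snd p) ps x"

text \<open>
  Following \<^const>\<open>auto\<close>, automorphisms are extensional functions, so they are compared with
  words on the carrier only.  The case \<open>m = 0\<close> adds nothing: a constant map is an automorphism
  only of the trivial group, where it is the identity.
\<close>
definition polynomial_autos :: "('a, 'b) monoid_scheme \<Rightarrow> ('a \<Rightarrow> 'a) set"
  where "polynomial_autos G =
    {f \<in> auto G. \<exists>u ps. u \<in> carrier G \<and> snd ` set ps \<subseteq> carrier G \<and>
                   (\<forall>x \<in> carrier G. f x = word_value G u ps x)}"

definition PolyAutoGroup :: "('a, 'b) monoid_scheme \<Rightarrow> ('a \<Rightarrow> 'a) monoid"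
  where "PolyAutoGroup G =
    (AutoGroup G)\<lparr>carrier := generate (AutoGroup G) (polynomial_autos G)\<rparr>"

end

theory Submission
  imports Defs
begin

text \<open>
  Let \<open>A\<close> be the derived subgroup of \<open>G\<close>, an abelian group on which conjugation makes \<open>G/A\<close> act.
  A polynomial automorphism acts on \<open>A\<close> as multiplication by an element of the commutative ring
  \<open>\<int>[G/A]\<close>, and on the abelian group \<open>G/A\<close> as a power map.  Hence the commutator of two polynomial
  automorphisms acts trivially on both \<open>A\<close> and \<open>G/A\<close>.  The automorphisms acting trivially on both
  form a normal subgroup of the automorphism group; it is abelian, since its elements have the form
  \<open>x \<mapsto> c(x) x\<close> with \<open>c(x)\<close> in \<open>A\<close> fixed by all the others.  Modulo this subgroup the generators
  of \<open>P(G)\<close> commute, so it contains the derived subgroup of \<open>P(G)\<close>.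
\<close>

section \<open>Commutators in generated subgroups, for arbitrary groups\<close>

lemma (in group) inv_mult_cancel_left:
  assumes "x \<in> carrier G" "y \<in> carrier G"
  shows "inv x \<otimes> (x \<otimes> y) = y" "x \<otimes> (inv x \<otimes> y) = y"
  using assms by (simp_all add: m_assoc[symmetric])

lemma (in group) generate_commute:
  assumes "S \<subseteq> carrier G" "t \<in> carrier G" "\<And>s. s \<in> S \<Longrightarrow> s \<otimes> t = t \<otimes> s" "h \<in> generate G S"
  shows "h \<otimes> t = t \<otimes> h"
  using assms(4)
proof (induction rule: generate.induct)
  case (inv h)
  then have h: "h \<in> carrier G" "h \<otimes> t = t \<otimes> h"
    using assms by auto
  then have "inv h \<otimes> (h \<otimes> t) \<otimes> inv h = inv h \<otimes> (t \<otimes> h) \<otimes> inv h"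
    by simp
  then show ?case
    using h(1) assms(2) by (simp add: inv_mult_cancel_left m_assoc)
next
  case (eng h1 h2)
  then have carr: "h1 \<in> carrier G" "h2 \<in> carrier G"
    using generate_in_carrier assms(1) by auto
  then have "h1 \<otimes> h2 \<otimes> t = h1 \<otimes> t \<otimes> h2"
    using eng.IH(2) assms(2) by (simp add: m_assoc)
  then show ?case
    using eng.IH(1) assms(2) carr by (simp add: m_assoc)
qed (use assms in auto)

text \<open>The centralizer argument of \<open>generate_commute\<close> is used twice: first to let
  each generator commute with \<open>k\<close>, then to let \<open>h\<close> commute with
  \<open>k\<close>.\<close>

lemma (in group) generate_commute2:
  assumes "S \<subseteq> carrier G" "\<And>s t. s \<in> S \<Longrightarrow> t \<in> S \<Longrightarrow> s \<otimes> t = t \<otimes> s"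
    and "h \<in> generate G S" "k \<in> generate G S"
  shows "h \<otimes> k = k \<otimes> h"
proof (rule generate_commute[OF assms(1) _ _ assms(3)])
  show "k \<in> carrier G"
    using assms generate_in_carrier by auto
  show "s \<otimes> k = k \<otimes> s" if "s \<in> S" for s
    using generate_commute[of S s k] assms that by auto
qed

text \<open>The commutator equals \<open>xy\<close> times the inverse of \<open>yx\<close>, so it
  lies in \<open>H\<close> exactly when \<open>xy\<close> and \<open>yx\<close> have the same
  coset.\<close>

lemma (in normal) commutator_in_iff:
  assumes "x \<in> carrier G" "y \<in> carrier G"
  shows "x \<otimes> y \<otimes> inv x \<otimes> inv y \<in> H \<longleftrightarrow> (H #> x) <#> (H #> y) = (H #> y) <#> (H #> x)"
proof -
  have "x \<otimes> y \<otimes> inv x \<otimes> inv y \<in> H \<longleftrightarrow> x \<otimes> y \<otimes> inv (y \<otimes> x) \<in> H"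
    using assms by (simp add: inv_mult_group m_assoc)
  also have "\<dots> \<longleftrightarrow> x \<otimes> y \<in> H #> (y \<otimes> x)"
    using assms by (simp add: rcos_module)
  also have "\<dots> \<longleftrightarrow> H #> (x \<otimes> y) = H #> (y \<otimes> x)"
    using assms repr_independence[of "x \<otimes> y" H "y \<otimes> x"] rcos_self[of "x \<otimes> y" H] subgroup_axioms
    by auto
  finally show ?thesis
    using assms by (simp add: rcos_sum)
qed

text \<open>The cosets of the elements of \<open>S\<close> commute pairwise and generate the image
  of \<open>generate G S\<close> in \<open>G Mod H\<close>. That image is therefore commutative,
  which pulls back to commutators lying in \<open>H\<close>.\<close>

lemma (in normal) derived_generate_subset:
  assumes S: "S \<subseteq> carrier G"
    and comm: "\<And>s t. s \<in> S \<Longrightarrow> t \<in> S \<Longrightarrow> s \<otimes> t \<otimes> inv s \<otimes> inv t \<in> H"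
  shows "derived G (generate G S) \<subseteq> H"
proof -
  interpret Q: group "G Mod H"
    by (rule factorgroup_is_group)
  interpret q: group_hom G "G Mod H" "\<lambda>a. H #> a"
    by unfold_locales (rule r_coset_hom_Mod)
  have gen: "generate (G Mod H) ((\<lambda>a. H #> a) ` S) = (\<lambda>a. H #> a) ` generate G S"
    using q.generate_img[OF S] by simp
  have "h \<otimes> k \<otimes> inv h \<otimes> inv k \<in> H" if hk: "h \<in> generate G S" "k \<in> generate G S" for h k
  proof -
    have "(H #> h) \<otimes>\<^bsub>G Mod H\<^esub> (H #> k) = (H #> k) \<otimes>\<^bsub>G Mod H\<^esub> (H #> h)"
    proof (rule Q.generate_commute2[of "(\<lambda>a. H #> a) ` S"])
      show "(\<lambda>a. H #> a) ` S \<subseteq> carrier (G Mod H)"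
        using S q.hom_closed by auto
      show "s \<otimes>\<^bsub>G Mod H\<^esub> t = t \<otimes>\<^bsub>G Mod H\<^esub> s"
        if "s \<in> (\<lambda>a. H #> a) ` S" "t \<in> (\<lambda>a. H #> a) ` S" for s t
        using that comm S commutator_in_iff by (auto simp: subset_iff)
    qed (use hk gen in auto)
    then show ?thesis
      using commutator_in_iff generate_in_carrier[OF S] hk by simp
  qed
  then show ?thesis
    unfolding derived_def
    by (intro generate_subgroup_incl subgroup_axioms) auto
qed

text \<open>The derived subgroup is the same whether computed in the generated subgroup or in
  \<open>G\<close>. It lies in \<open>N\<close>, whose elements commute.\<close>

lemma metabelian_generateI:
  assumes "N \<lhd> G" "S \<subseteq> carrier G"
    and "\<And>s t. s \<in> S \<Longrightarrow> t \<in> S \<Longrightarrow> s \<otimes>\<^bsub>G\<^esub> t \<otimes>\<^bsub>G\<^esub> inv\<^bsub>G\<^esub> s \<otimes>\<^bsub>G\<^esub> inv\<^bsub>G\<^esub> t \<in> N"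
    and comm: "\<And>h k. h \<in> N \<Longrightarrow> k \<in> N \<Longrightarrow> h \<otimes>\<^bsub>G\<^esub> k = k \<otimes>\<^bsub>G\<^esub> h"
  shows "metabelian (G\<lparr>carrier := generate G S\<rparr>)"
proof -
  interpret normal N G by fact
  let ?P = "G\<lparr>carrier := generate G S\<rparr>"
  have sub: "subgroup (generate G S) G"
    using assms(2) by (rule generate_is_subgroup)
  interpret P: group ?P
    using sub by (rule subgroup_imp_group)
  have "derived ?P (carrier ?P) = derived G (generate G S)"
    using derived_consistent[OF _ sub] by simp
  also have "\<dots> \<subseteq> N"
    using assms by (intro derived_generate_subset)
  finally have "derived ?P (carrier ?P) \<subseteq> N" .
  moreover have "group (?P\<lparr>carrier := derived ?P (carrier ?P)\<rparr>)"
    by (intro P.subgroup_imp_group P.derived_is_subgroup) simp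
  ultimately have "comm_group (?P\<lparr>carrier := derived ?P (carrier ?P)\<rparr>)"
    by (intro group.group_comm_groupI) (auto intro: comm simp: subset_iff)
  then show ?thesis
    by (simp add: metabelian_def P.group_axioms)
qed

section \<open>Metabelian groups and their automorphisms\<close>

locale metabelian_group = group G for G :: "('a, 'b) monoid_scheme" (structure) +
  fixes A
  defines "A \<equiv> derived G (carrier G)"
  assumes A_comm: "a \<in> A \<Longrightarrow> b \<in> A \<Longrightarrow> a \<otimes> b = b \<otimes> a"

sublocale metabelian_group \<subseteq> A: normal A G
  unfolding A_def by (rule derived_self_is_normal)

lemma metabelian_groupI: "metabelian G \<Longrightarrow> metabelian_group G"
  unfolding metabelian_def metabelian_group_def metabelian_group_axioms_def
  using comm_groupE(4) by fastforce

context metabelian_group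
begin

lemma commutator_in: "x \<in> carrier G \<Longrightarrow> y \<in> carrier G \<Longrightarrow> x \<otimes> y \<otimes> inv x \<otimes> inv y \<in> A"
  unfolding A_def derived_def by (intro generate.incl) blast

lemma auto_mult: "f \<in> auto G \<Longrightarrow> x \<in> carrier G \<Longrightarrow> y \<in> carrier G \<Longrightarrow> f (x \<otimes> y) = f x \<otimes> f y"
  by (simp add: auto_def hom_mult)

lemma auto_closed: "f \<in> auto G \<Longrightarrow> x \<in> carrier G \<Longrightarrow> f x \<in> carrier G"
  by (auto simp: auto_def hom_def)

lemma auto_group_hom: "f \<in> auto G \<Longrightarrow> group_hom G G f"
  by unfold_locales (simp add: auto_def)

text \<open>The derived subgroup is characteristic: a surjective endomorphism maps it onto
  itself.\<close>

lemma auto_derived: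
  assumes "f \<in> auto G" "a \<in> A"
  shows "f a \<in> A"
proof -
  interpret f: group_hom G G f
    using assms(1) by (rule auto_group_hom)
  have "f ` carrier G = carrier G"
    using assms(1) by (simp add: auto_def Bij_def bij_betw_def)
  then have "f ` A = A"
    unfolding A_def using f.derived_img[of "carrier G"] by simp
  then show ?thesis
    using assms(2) by auto
qed

section \<open>Module endomorphisms of the derived subgroup\<close>

text \<open>The maps commuting with the \<open>\<int>[G/A]\<close>-module structure of \<open>A\<close>.\<close>
definition module_end :: "('a \<Rightarrow> 'a) \<Rightarrow> bool" where
  "module_end \<phi> \<longleftrightarrow> (\<forall>a\<in>A. \<phi> a \<in> A) \<and> (\<forall>a\<in>A. \<forall>b\<in>A. \<phi> (a \<otimes> b) = \<phi> a \<otimes> \<phi> b) \<and>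
    (\<forall>a\<in>A. \<forall>g\<in>carrier G. \<phi> (g \<otimes> a \<otimes> inv g) = g \<otimes> \<phi> a \<otimes> inv g)"

lemma module_end_int_pow:
  assumes "module_end \<phi>" "a \<in> A"
  shows "\<phi> (a [^] (n::int)) = \<phi> a [^] n"
proof -
  let ?A = "G\<lparr>carrier := A\<rparr>"
  interpret A': group ?A
    by (rule subgroup_imp_group) (rule A.subgroup_axioms)
  interpret group_hom ?A ?A \<phi>
    using assms(1) by unfold_locales (auto simp: module_end_def hom_def)
  have "\<phi> a \<in> A"
    using assms by (simp add: module_end_def)
  then show ?thesis
    using hom_int_pow[of a n] assms(2) int_pow_consistent[OF A.subgroup_axioms] by simp
qed

text \<open>This is where commutativity of \<open>A\<close> enters: \<open>hg\<close> and
  \<open>gh\<close> differ by an element \<open>c\<close> of \<open>A\<close>, and conjugation by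
  \<open>c\<close> is trivial on \<open>A\<close>.\<close>

lemma module_end_conjugation:
  assumes g: "g \<in> carrier G"
  shows "module_end (\<lambda>a. g \<otimes> a \<otimes> inv g)"
  unfolding module_end_def
proof (intro conjI ballI)
  fix a assume a: "a \<in> A"
  then show "g \<otimes> a \<otimes> inv g \<in> A"
    using g by (rule A.inv_op_closed2[rotated])
  fix b assume "b \<in> A"
  then show "g \<otimes> (a \<otimes> b) \<otimes> inv g = g \<otimes> a \<otimes> inv g \<otimes> (g \<otimes> b \<otimes> inv g)"
    using a g by (simp add: m_assoc inv_mult_cancel_left)
next
  fix a h assume a: "a \<in> A" and h: "h \<in> carrier G"
  define c where "c = h \<otimes> g \<otimes> inv h \<otimes> inv g"
  define b where "b = g \<otimes> h \<otimes> a \<otimes> inv (g \<otimes> h)"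
  have c: "c \<in> A" and b: "b \<in> A"
    unfolding b_def c_def using g h a A.inv_op_closed2[of "g \<otimes> h" a] by (auto intro: commutator_in)
  have [simp]: "a \<in> carrier G" "b \<in> carrier G" "c \<in> carrier G"
    using a b c by auto
  have hg: "h \<otimes> g = c \<otimes> (g \<otimes> h)"
    using g h by (simp add: c_def m_assoc inv_mult_cancel_left)
  have "h \<otimes> (g \<otimes> a \<otimes> inv g) \<otimes> inv h = (h \<otimes> g) \<otimes> a \<otimes> inv (h \<otimes> g)"
    using g h by (simp add: inv_mult_group m_assoc)
  also have "\<dots> = c \<otimes> b \<otimes> inv c"
    unfolding b_def hg using g h by (simp add: inv_mult_group m_assoc)
  also have "\<dots> = b"
    unfolding A_comm[OF c b] by (simp add: m_assoc)
  also have "b = g \<otimes> (h \<otimes> a \<otimes> inv h) \<otimes> inv g"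
    unfolding b_def using g h by (simp add: inv_mult_group m_assoc)
  finally show "g \<otimes> (h \<otimes> a \<otimes> inv h) \<otimes> inv g = h \<otimes> (g \<otimes> a \<otimes> inv g) \<otimes> inv h"
    by simp
qed

section \<open>Word maps on \<open>A\<close> and modulo \<open>A\<close>\<close>

lemma word_value_closed:
  assumes "u \<in> carrier G" "snd ` set ps \<subseteq> carrier G" "x \<in> carrier G"
  shows "word_value G u ps x \<in> carrier G"
  using assms by (induction ps arbitrary: u) auto

text \<open>
  On \<open>A\<close>, a word is a \<open>\<int>[G/A]\<close>-multiple of its argument times its value at \<open>\<one>\<close>.  The multiplier is
  characterised by commuting with all module endomorphisms, which avoids the group ring.
\<close>
lemma word_value_module_end:
  assumes "u \<in> carrier G" "snd ` set ps \<subseteq> carrier G" "module_end \<phi>" "a \<in> A"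
  shows "word_value G u ps a \<otimes> inv (word_value G u ps \<one>) \<in> A \<and>
    \<phi> (word_value G u ps a \<otimes> inv (word_value G u ps \<one>)) =
      word_value G u ps (\<phi> a) \<otimes> inv (word_value G u ps \<one>)"
  using assms(1,2)
proof (induction ps arbitrary: u)
  case Nil
  have "\<phi> \<one> = \<one>"
    using module_end_int_pow[OF assms(3), of \<one> 0] by simp
  then show ?case using Nil by simp
next
  case (Cons p ps)
  have \<phi>: "\<And>a. a \<in> A \<Longrightarrow> \<phi> a \<in> A" "\<And>a b. a \<in> A \<Longrightarrow> b \<in> A \<Longrightarrow> \<phi> (a \<otimes> b) = \<phi> a \<otimes> \<phi> b"
      "\<And>a g. a \<in> A \<Longrightarrow> g \<in> carrier G \<Longrightarrow> \<phi> (g \<otimes> a \<otimes> inv g) = g \<otimes> \<phi> a \<otimes> inv g"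
    using assms(3) by (auto simp: module_end_def)
  have u: "u \<in> carrier G" "snd p \<in> carrier G" "snd ` set ps \<subseteq> carrier G"
    using Cons.prems by auto
  define w where "w = word_value G (snd p) ps"
  have w: "w x \<in> carrier G" if "x \<in> carrier G" for x
    unfolding w_def using u that word_value_closed by simp
  \<comment> \<open>Intermediate words need not map \<open>A\<close> into \<open>A\<close>, but the
    quotients by the values at 1 stay in \<open>A\<close>. Each letter changes such a quotient by a
    power of \<open>b\<close> and a conjugation, both compatible with \<phi>. The identity is needed
    at \<open>a\<close> and at \<open>\<phi> a\<close>.\<close>
  have step: "word_value G u (p # ps) b \<otimes> inv (word_value G u (p # ps) \<one>) =
      u \<otimes> (b [^] fst p \<otimes> (w b \<otimes> inv (w \<one>))) \<otimes> inv u" if "b \<in> A" for b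
    using that u w by (simp add: w_def[symmetric] inv_mult_group m_assoc)
  have IH: "w a \<otimes> inv (w \<one>) \<in> A" "\<phi> (w a \<otimes> inv (w \<one>)) = w (\<phi> a) \<otimes> inv (w \<one>)"
    using Cons.IH[OF u(2,3)] by (simp_all add: w_def)
  have pow: "a [^] fst p \<in> A"
    using assms(4) subgroup_int_pow_closed[OF A.subgroup_axioms] by simp
  then show ?case
    using IH u(1) assms(4) \<phi> A.inv_op_closed2 A.m_closed
    by (simp only: step module_end_int_pow[OF assms(3)])
qed

text \<open>Since \<open>G/A\<close> is abelian, all powers of \<open>x\<close> can be gathered in
  front of the coefficients, whose product is the value at 1. The induction builds \<open>n\<close>
  as the sum of the exponents.\<close>

lemma word_value_mod_derived:
  assumes "u \<in> carrier G" "snd ` set ps \<subseteq> carrier G"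
  shows "\<exists>n::int. \<forall>x\<in>carrier G. \<exists>c\<in>A. word_value G u ps x = c \<otimes> (x [^] n \<otimes> word_value G u ps \<one>)"
  using assms
proof (induction ps arbitrary: u)
  case Nil
  then show ?case
    by (intro exI[of _ 0]) (auto intro!: bexI[of _ \<one>])
next
  case (Cons p ps)
  have u: "u \<in> carrier G" "snd p \<in> carrier G" "snd ` set ps \<subseteq> carrier G"
    using Cons.prems by auto
  define w where "w = word_value G (snd p) ps"
  have w: "w x \<in> carrier G" if "x \<in> carrier G" for x
    unfolding w_def using u that word_value_closed by simp
  obtain n :: int where n: "\<And>x. x \<in> carrier G \<Longrightarrow> \<exists>c\<in>A. w x = c \<otimes> (x [^] n \<otimes> w \<one>)"
    using Cons.IH[OF u(2,3)] unfolding w_def by blast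
  show ?case
  proof (intro exI[of _ "fst p + n"] ballI)
    fix x assume x: "x \<in> carrier G"
    then obtain c where c: "c \<in> A" "w x = c \<otimes> (x [^] n \<otimes> w \<one>)"
      using n by blast
    define y where "y = x [^] fst p"
    define z where "z = x [^] n"
    \<comment> \<open>The factor \<open>d\<close> is \<open>c\<close> carried to the front past
      \<open>u\<close> and \<open>y\<close>; the commutator \<open>e\<close> pays for moving
      \<open>u\<close> behind the powers of \<open>x\<close>.\<close>
    define d where "d = u \<otimes> y \<otimes> c \<otimes> inv (u \<otimes> y)"
    define e where "e = u \<otimes> (y \<otimes> z) \<otimes> inv u \<otimes> inv (y \<otimes> z)"
    have yz: "y \<in> carrier G" "z \<in> carrier G" "x [^] (fst p + n) = y \<otimes> z"
      using x by (auto simp: y_def z_def int_pow_mult)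
    have "d \<in> A" "e \<in> A"
      unfolding d_def e_def using c u yz A.inv_op_closed2 by (auto intro: commutator_in)
    moreover have "u \<otimes> y \<otimes> (c \<otimes> (z \<otimes> w \<one>)) = d \<otimes> e \<otimes> (y \<otimes> z \<otimes> (u \<otimes> w \<one>))"
      unfolding d_def e_def using c u yz w[of \<one>]
      by (simp add: inv_mult_group m_assoc inv_mult_cancel_left)
    ultimately show "\<exists>c\<in>A. word_value G u (p # ps) x =
        c \<otimes> (x [^] (fst p + n) \<otimes> word_value G u (p # ps) \<one>)"
      using u w[of \<one>] c yz
      by (intro bexI[of _ "d \<otimes> e"]) (simp_all add: w_def[symmetric] y_def[symmetric] z_def[symmetric])
  qed
qed

section \<open>Polynomial automorphisms on \<open>A\<close> and modulo \<open>A\<close>\<close>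

lemma polynomial_auto_E:
  assumes "f \<in> polynomial_autos G"
  obtains u ps where "f \<in> auto G" "u \<in> carrier G" "snd ` set ps \<subseteq> carrier G"
    "\<And>x. x \<in> carrier G \<Longrightarrow> f x = word_value G u ps x" "word_value G u ps \<one> = \<one>"
proof -
  obtain u ps where f: "f \<in> auto G" "u \<in> carrier G" "snd ` set ps \<subseteq> carrier G"
    "\<And>x. x \<in> carrier G \<Longrightarrow> f x = word_value G u ps x"
    using assms by (auto simp: polynomial_autos_def)
  \<comment> \<open>This removes the correction by the value at 1 from both word lemmas.\<close>
  moreover have "f \<one> = \<one>"
    using auto_group_hom[OF f(1)] by (rule group_hom.hom_one)
  ultimately show ?thesis
    using that by simp
qed

lemma polynomial_auto_commute_module_end:
  assumes "f \<in> polynomial_autos G" "module_end \<phi>" "a \<in> A"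
  shows "\<phi> (f a) = f (\<phi> a)"
proof -
  obtain u ps where f: "u \<in> carrier G" "snd ` set ps \<subseteq> carrier G"
    "\<And>x. x \<in> carrier G \<Longrightarrow> f x = word_value G u ps x" "word_value G u ps \<one> = \<one>"
    using polynomial_auto_E[OF assms(1)] by metis
  have "\<phi> a \<in> A"
    using assms by (simp add: module_end_def)
  then show ?thesis
    using word_value_module_end[OF f(1,2) assms(2,3)] f assms(3) word_value_closed by simp
qed

text \<open>Conjugations are module endomorphisms, so \<open>f\<close> commutes with them on
  \<open>A\<close>; this is compatibility with the action of \<open>G\<close>. Consequently two
  polynomial automorphisms commute on \<open>A\<close>.\<close>

lemma module_end_polynomial_auto:
  assumes "f \<in> polynomial_autos G"
  shows "module_end f"
  using assms polynomial_auto_commute_module_end[OF assms module_end_conjugation] auto_derived auto_mult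
  by (auto simp: module_end_def polynomial_autos_def)

text \<open>Modulo \<open>A\<close>, \<open>f\<close> is a power map, and power maps commute with
  every automorphism; hence \<open>g\<close> may be arbitrary.\<close>

lemma polynomial_auto_mod_derived:
  assumes f: "f \<in> polynomial_autos G" and g: "g \<in> auto G" and x: "x \<in> carrier G"
  shows "\<exists>c\<in>A. f (g x) = c \<otimes> g (f x)"
proof -
  obtain u ps where u: "u \<in> carrier G" "snd ` set ps \<subseteq> carrier G"
    "\<And>x. x \<in> carrier G \<Longrightarrow> f x = word_value G u ps x" "word_value G u ps \<one> = \<one>"
    using polynomial_auto_E[OF f] by metis
  obtain n :: int where n: "\<And>x. x \<in> carrier G \<Longrightarrow> \<exists>c\<in>A. f x = c \<otimes> x [^] n"
    using word_value_mod_derived[OF u(1,2)] u(3,4) by auto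
  interpret g: group_hom G G g
    using g by (rule auto_group_hom)
  obtain c where c: "c \<in> A" "f (g x) = c \<otimes> g x [^] n"
    using n[of "g x"] auto_closed[OF g x] by blast
  obtain d where d: "d \<in> A" "f x = d \<otimes> x [^] n"
    using n[OF x] by blast
  have "g d \<in> A"
    using g d(1) by (rule auto_derived)
  moreover have "g (f x) = g d \<otimes> g x [^] n"
    using d x by (simp add: g.hom_int_pow)
  \<comment> \<open>Both sides are multiples of the same power of \<open>g x\<close>, by
    \<open>c\<close> and by \<open>g d\<close>, so the factors are compared.\<close>
  then have "f (g x) = c \<otimes> inv (g d) \<otimes> g (f x)"
    using c \<open>g d \<in> A\<close> x by (simp add: m_assoc inv_mult_cancel_left)
  ultimately show ?thesis
    using c(1) by blast
qed

section \<open>The stabilizer of the series 1, \<open>A\<close>, \<open>G\<close> in the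
  automorphism group\<close>

definition stabilizer_autos :: "('a \<Rightarrow> 'a) set" where
  "stabilizer_autos = {h \<in> auto G. (\<forall>a\<in>A. h a = a) \<and> (\<forall>x\<in>carrier G. \<exists>c\<in>A. h x = c \<otimes> x)}"

sublocale Aut: group "AutoGroup G"
  by (rule AutoGroup)

lemma Aut_carrier [simp]: "carrier (AutoGroup G) = auto G"
  by (simp add: AutoGroup_def)

lemma Aut_mult:
  assumes "f \<in> auto G" "g \<in> auto G" "x \<in> carrier G"
  shows "(f \<otimes>\<^bsub>AutoGroup G\<^esub> g) x = f (g x)"
  using assms by (simp add: AutoGroup_def BijGroup_def auto_def compose_def)

lemma Aut_one: "x \<in> carrier G \<Longrightarrow> \<one>\<^bsub>AutoGroup G\<^esub> x = x"
  by (simp add: AutoGroup_def BijGroup_def)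

lemma auto_ext:
  assumes "f \<in> auto G" "g \<in> auto G" "\<And>x. x \<in> carrier G \<Longrightarrow> f x = g x"
  shows "f = g"
  using assms by (auto simp: auto_def Bij_def intro: extensionalityI)

lemma Aut_inv:
  assumes "f \<in> auto G" "x \<in> carrier G"
  shows "(inv\<^bsub>AutoGroup G\<^esub> f) (f x) = x" "f ((inv\<^bsub>AutoGroup G\<^esub> f) x) = x"
  using assms Aut.l_inv[of f] Aut.r_inv[of f] Aut_mult[of "inv\<^bsub>AutoGroup G\<^esub> f" f x]
    Aut_mult[of f "inv\<^bsub>AutoGroup G\<^esub> f" x] Aut_one Aut.inv_closed[of f]
  by simp_all

lemma Aut_inv_closed: "f \<in> auto G \<Longrightarrow> inv\<^bsub>AutoGroup G\<^esub> f \<in> auto G"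
  using Aut.inv_closed[of f] by simp

lemma Aut_mult_closed: "f \<in> auto G \<Longrightarrow> g \<in> auto G \<Longrightarrow> f \<otimes>\<^bsub>AutoGroup G\<^esub> g \<in> auto G"
  using Aut.m_closed[of f g] by simp

lemma stabilizer_autos_commute:
  assumes "h \<in> stabilizer_autos" "k \<in> stabilizer_autos"
  shows "h \<otimes>\<^bsub>AutoGroup G\<^esub> k = k \<otimes>\<^bsub>AutoGroup G\<^esub> h"
proof (rule auto_ext)
  have hk: "h \<in> auto G" "k \<in> auto G"
    using assms by (auto simp: stabilizer_autos_def)
  then show "h \<otimes>\<^bsub>AutoGroup G\<^esub> k \<in> auto G" "k \<otimes>\<^bsub>AutoGroup G\<^esub> h \<in> auto G"
    by (auto intro: Aut_mult_closed)
  fix x assume x: "x \<in> carrier G"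
  obtain c d where cd: "c \<in> A" "d \<in> A" "h x = c \<otimes> x" "k x = d \<otimes> x"
    using assms x unfolding stabilizer_autos_def by blast
  \<comment> \<open>Hence \<open>h (k x)\<close> is \<open>dcx\<close> and \<open>k (h x)\<close> is
    \<open>cdx\<close>.\<close>
  then have "h d = d" "k c = c"
    using assms by (auto simp: stabilizer_autos_def)
  then show "(h \<otimes>\<^bsub>AutoGroup G\<^esub> k) x = (k \<otimes>\<^bsub>AutoGroup G\<^esub> h) x"
    using hk cd x A_comm[of c d] by (simp add: Aut_mult auto_mult m_assoc[symmetric])
qed

lemma stabilizer_autos_normal: "stabilizer_autos \<lhd> AutoGroup G"
proof (rule Aut.normal_invI)
  show "subgroup stabilizer_autos (AutoGroup G)"
  proof (rule Aut.subgroupI)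
    show "stabilizer_autos \<subseteq> carrier (AutoGroup G)"
      by (auto simp: stabilizer_autos_def)
    have "\<one>\<^bsub>AutoGroup G\<^esub> \<in> stabilizer_autos"
      using Aut.one_closed by (auto simp: stabilizer_autos_def Aut_one intro!: bexI[of _ \<one>])
    then show "stabilizer_autos \<noteq> {}"
      by blast
  next
    fix h assume h: "h \<in> stabilizer_autos"
    then have aut: "h \<in> auto G" "inv\<^bsub>AutoGroup G\<^esub> h \<in> auto G"
      by (auto simp: stabilizer_autos_def Aut_inv_closed)
    have fix_A: "(inv\<^bsub>AutoGroup G\<^esub> h) a = a" if "a \<in> A" for a
      using Aut_inv(1)[OF aut(1), of a] h that by (simp add: stabilizer_autos_def)
    have "\<exists>c\<in>A. (inv\<^bsub>AutoGroup G\<^esub> h) x = c \<otimes> x" if x: "x \<in> carrier G" for x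
    proof -
      obtain c where c: "c \<in> A" "h x = c \<otimes> x"
        using h x by (auto simp: stabilizer_autos_def)
      \<comment> \<open>The inverse of \<open>h\<close> is applied to
        \<open>h x = c \<otimes> x\<close>; it fixes \<open>c\<close>.\<close>
      have "x = c \<otimes> (inv\<^bsub>AutoGroup G\<^esub> h) x"
        using Aut_inv(1)[OF aut(1) x] c aut(2) x fix_A by (simp add: auto_mult)
      then have "(inv\<^bsub>AutoGroup G\<^esub> h) x = inv c \<otimes> x"
        using c x auto_closed[OF aut(2) x] by (simp add: inv_solve_left)
      then show ?thesis
        using c(1) by blast
    qed
    then show "inv\<^bsub>AutoGroup G\<^esub> h \<in> stabilizer_autos"
      using aut fix_A by (simp add: stabilizer_autos_def)
  next
    fix h k assume hk: "h \<in> stabilizer_autos" "k \<in> stabilizer_autos"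
    then have aut: "h \<in> auto G" "k \<in> auto G"
      by (auto simp: stabilizer_autos_def)
    have "\<exists>c\<in>A. h (k x) = c \<otimes> x" if x: "x \<in> carrier G" for x
    proof -
      obtain c d where cd: "c \<in> A" "d \<in> A" "h x = c \<otimes> x" "k x = d \<otimes> x"
        using hk x unfolding stabilizer_autos_def by blast
      then have "h (k x) = d \<otimes> c \<otimes> x"
        using hk x aut by (simp add: auto_mult stabilizer_autos_def m_assoc)
      then show ?thesis
        using cd by blast
    qed
    then show "h \<otimes>\<^bsub>AutoGroup G\<^esub> k \<in> stabilizer_autos"
      using hk aut Aut_mult_closed by (simp add: stabilizer_autos_def Aut_mult)
  qed
next
  fix f h assume f: "f \<in> carrier (AutoGroup G)" and h: "h \<in> stabilizer_autos"
  define f' where "f' = inv\<^bsub>AutoGroup G\<^esub> f"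
  have aut: "f \<in> auto G" "f' \<in> auto G" "h \<in> auto G"
    using f h by (auto simp: f'_def stabilizer_autos_def Aut_inv_closed)
  have ff': "f (f' x) = x" if "x \<in> carrier G" for x
    using Aut_inv(2) aut(1) that by (simp add: f'_def)
  have "f (h (f' a)) = a" if "a \<in> A" for a
    using h that ff' auto_derived[OF aut(2)] by (simp add: stabilizer_autos_def)
  moreover have "\<exists>c\<in>A. f (h (f' x)) = c \<otimes> x" if x: "x \<in> carrier G" for x
  proof -
    have "f' x \<in> carrier G"
      using aut(2) x by (rule auto_closed)
    then obtain c where c: "c \<in> A" "h (f' x) = c \<otimes> f' x"
      using h by (auto simp: stabilizer_autos_def)
    \<comment> \<open>Conjugation by \<open>f\<close> replaces the factor \<open>c\<close> by
      \<open>f c\<close>, which is again in \<open>A\<close> because \<open>A\<close> is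
      characteristic.\<close>
    then have "f (h (f' x)) = f c \<otimes> x"
      using aut x ff' \<open>f' x \<in> carrier G\<close> by (simp add: auto_mult)
    then show ?thesis
      using auto_derived[OF aut(1) c(1)] by blast
  qed
  ultimately show "f \<otimes>\<^bsub>AutoGroup G\<^esub> h \<otimes>\<^bsub>AutoGroup G\<^esub> inv\<^bsub>AutoGroup G\<^esub> f \<in> stabilizer_autos"
    using aut unfolding f'_def[symmetric]
    by (simp add: stabilizer_autos_def Aut_mult Aut_mult_closed auto_closed)
qed

section \<open>Commutators of polynomial automorphisms, and the conclusion\<close>

lemma polynomial_autos_commutator:
  assumes fg: "f \<in> polynomial_autos G" "g \<in> polynomial_autos G"
  shows "f \<otimes>\<^bsub>AutoGroup G\<^esub> g \<otimes>\<^bsub>AutoGroup G\<^esub> inv\<^bsub>AutoGroup G\<^esub> f \<otimes>\<^bsub>AutoGroup G\<^esub> inv\<^bsub>AutoGroup G\<^esub> g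
    \<in> stabilizer_autos"
proof -
  define f' where "f' = inv\<^bsub>AutoGroup G\<^esub> f"
  define g' where "g' = inv\<^bsub>AutoGroup G\<^esub> g"
  have aut: "f \<in> auto G" "g \<in> auto G" "f' \<in> auto G" "g' \<in> auto G"
    using fg by (auto simp: polynomial_autos_def f'_def g'_def Aut_inv_closed)
  have inv: "f (f' x) = x" "g (g' x) = x" if "x \<in> carrier G" for x
    using Aut_inv(2) aut that by (auto simp: f'_def g'_def)
  have "f (g (f' (g' a))) = a" if a: "a \<in> A" for a
  proof -
    have "f' (g' a) \<in> A" "g' a \<in> A"
      using a aut auto_derived by auto
    then show ?thesis
      \<comment> \<open>Here \<open>f\<close> plays the role of the module endomorphism:
        \<open>f\<close> and \<open>g\<close> are swapped at the point \<open>f' (g' a)\<close> of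
        \<open>A\<close>, after which the inverses cancel.\<close>
      using polynomial_auto_commute_module_end[OF fg(2) module_end_polynomial_auto[OF fg(1)]] inv a
      by simp
  qed
  moreover have "\<exists>c\<in>A. f (g (f' (g' x))) = c \<otimes> x" if x: "x \<in> carrier G" for x
    \<comment> \<open>The same swap at \<open>f' (g' x)\<close>, now at the cost of a factor in
      \<open>A\<close>.\<close>
    using polynomial_auto_mod_derived[OF fg(1) aut(2), of "f' (g' x)"] inv x aut auto_closed by simp
  ultimately show ?thesis
    using aut unfolding f'_def[symmetric] g'_def[symmetric]
    by (simp add: stabilizer_autos_def Aut_mult Aut_mult_closed auto_closed)
qed

end

theorem theorem1p2:
  fixes G :: "('a, 'b) monoid_scheme"
  assumes "metabelian G"
  shows "metabelian (PolyAutoGroup G)"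
proof -
  interpret metabelian_group G "derived G (carrier G)"
    using assms by (rule metabelian_groupI)
  show ?thesis
    unfolding PolyAutoGroup_def
  \<comment> \<open>The normal subgroup \<open>N\<close> stays schematic here; the closing
    \<open>fact\<close> steps instantiate it with \<open>stabilizer_autos\<close>.\<close>
  proof (rule metabelian_generateI)
    show "polynomial_autos G \<subseteq> carrier (AutoGroup G)"
      by (auto simp: polynomial_autos_def)
  qed (fact stabilizer_autos_normal polynomial_autos_commutator stabilizer_autos_commute)+
qed

end
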